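(* Let $k$ be a complete valuation field whose valuation is trivial, i.e. $|c|=1$ for all $c\in k\setminus\{0\}$. Then for any Banach $k$-vector space $V$, the following are equivalent: (1) $V$ is free. (2) $V$ is almost free, and, if $\dim_k V=1$, $V$ is isomorphic to $k$ (by an isometric $k$-linear isomorphism). (3) $\|V\|\subset|k|$, where $\|V\|=\{\|v\|:v\in V\}$ and $|k|=\{|c|:c\in k\}$.
   Context: A complete valuation field is a field $k$ with a map $|\cdot|:k\to\mathbb{R}_{\ge 0}$ such that $|c|=0$ iff $c=0$, $|c_0-c_1|\le\max\{|c_0|,|c_1|\}$, $|c_0c_1|=|c_0||c_1|$, and $k$ is complete for the ultrametric $|c_0-c_1|$. A Banach $k$-vector space is a $k$-vector space $V$ with a map $\|\cdot\|:V\to\mathbb{R}_{\ge 0}$ such that $\|v\|=0$ iff $v=0$, $\|v_0-v_1\|\le\max\{\|v_0\|,\|v_1\|\}$, $\|cv\|=|c|\|v\|$, and $V$ is complete for the ultrametric $\|v_0-v_1\|$. Closed $k$-linear subspaces carry the restricted norm and are Banach $k$-vector spaces. For a set $E$, $C_0(E,k)$ is the Banach $k$-vector space of maps $c:E\to k$ such that $\{e\in E:|c(e)|\ge\epsilon\}$ is finite for every $\epsilon>0$, with the norm $\|c\|=\sup_{e\in E}|c(e)|$ (equal to $0$ if $E=\emptyset$). An orthonormal Schauder basis of $V$ is a subset $E\subset V$ such that $\|e\|=1$ for all $e\in E$; $\|\sum_{e\in E}c(e)e\|=\|c\|$ for all $c\in C_0(E,k)$; and every $v\in V$ equals $\sum_{e\in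 E}c(e)e$ for some $c\in C_0(E,k)$ (the sums being the usual limits of finite sums). For $S\subset V$, $\langle S\rangle$ is the closure of the $k$-linear span of $S$. $\mathrm{rank}(V)$ is the minimum cardinality of a subset $S\subset V$ with $V=\langle S\rangle$. $V$ is free if it admits an orthonormal Schauder basis; for a cardinal $\kappa$, $V$ is $\kappa$-free if every closed subspace of the form $\langle S\rangle$ with $S\subset V$ of cardinality $<\kappa$ is free; $V$ is almost free if it is $\mathrm{rank}(V)$-free. *)

theory Defs
  imports "HOL-Analysis.Analysis"
begin

unbundle cardinal_syntax

locale complete_valued_field =
  fixes val :: "'k::field \<Rightarrow> real"
  assumes val_nonneg: "0 \<le> val c"
    and val_eq_0_iff: "val c = 0 \<longleftrightarrow> c = 0"
    and val_diff_le_max: "val (c - d) \<le> max (val c) (val d)"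
    and val_mult: "val (c * d) = val c * val d"
    and val_complete: "Metric_space.mcomplete UNIV (\<lambda>c d. val (c - d))"
begin

text \<open>The index set is a set rather than a type, so a map on \<open>E\<close> is an extensional function.\<close>

definition C0 :: "'e set \<Rightarrow> ('e \<Rightarrow> 'k) set" where
  "C0 E = {c \<in> E \<rightarrow>\<^sub>E UNIV. \<forall>\<epsilon>>0. finite {e \<in> E. \<epsilon> \<le> val (c e)}}"

definition C0_norm :: "'e set \<Rightarrow> ('e \<Rightarrow> 'k) \<Rightarrow> real" where
  "C0_norm E c = (if E = {} then 0 else (SUP e\<in>E. val (c e)))"

end

text \<open>A Banach space over \<open>'k\<close> is the whole type \<open>'v\<close>; its closed subspaces are sets \<open>W :: 'v set\<close>,
  with the norm restricted from \<open>'v\<close>.\<close>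

locale banach_vector_space = complete_valued_field val + vector_space scale
  for val :: "'k::field \<Rightarrow> real"
    and scale :: "'k \<Rightarrow> 'v::ab_group_add \<Rightarrow> 'v" +
  fixes nrm :: "'v \<Rightarrow> real"
  assumes nrm_nonneg: "0 \<le> nrm v"
    and nrm_eq_0_iff: "nrm v = 0 \<longleftrightarrow> v = 0"
    and nrm_diff_le_max: "nrm (v - w) \<le> max (nrm v) (nrm w)"
    and nrm_scale: "nrm (scale c v) = val c * nrm v"
    and nrm_complete: "Metric_space.mcomplete UNIV (\<lambda>v w. nrm (v - w))"
begin

abbreviation norm_topology :: "'v topology" where
  "norm_topology \<equiv> Metric_space.mtopology UNIV (\<lambda>v w. nrm (v - w))"

definition sums_to :: "'v set \<Rightarrow> ('v \<Rightarrow> 'k) \<Rightarrow> 'v \<Rightarrow> bool" where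
  "sums_to E c v \<longleftrightarrow>
     limitin norm_topology (\<lambda>F. \<Sum>e\<in>F. scale (c e) e) v (finite_subsets_at_top E)"

definition orthonormal_schauder_basis :: "'v set \<Rightarrow> 'v set \<Rightarrow> bool" where
  "orthonormal_schauder_basis W E \<longleftrightarrow>
     E \<subseteq> W \<and>
     (\<forall>e\<in>E. nrm e = 1) \<and>
     (\<forall>c\<in>C0 E. \<exists>v\<in>W. sums_to E c v \<and> nrm v = C0_norm E c) \<and>
     (\<forall>v\<in>W. \<exists>c\<in>C0 E. sums_to E c v)"

definition is_free :: "'v set \<Rightarrow> bool" where
  "is_free W \<longleftrightarrow> (\<exists>E. orthonormal_schauder_basis W E)"

definition closed_span :: "'v set \<Rightarrow> 'v set" where
  "closed_span S = norm_topology closure_of (span S)"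

text \<open>The minimum cardinality of a topologically generating set, as a cardinal order on \<open>'v\<close>;
  it is determined only up to \<open>=o\<close>, which is all that comparisons with \<open><o\<close> depend on.\<close>

definition banach_rank :: "'v rel" where
  "banach_rank = (SOME r. \<exists>S. closed_span S = UNIV \<and> r = |S| \<and>
                     (\<forall>T. closed_span T = UNIV \<longrightarrow> |S| \<le>o |T| ))"

definition kappa_free :: "'c rel \<Rightarrow> bool" where
  "kappa_free \<kappa> \<longleftrightarrow> (\<forall>S. |S| <o \<kappa> \<longrightarrow> is_free (closed_span S))"

definition almost_free :: bool where
  "almost_free \<longleftrightarrow> kappa_free banach_rank"

definition isometric_to_field :: bool where
  "isometric_to_field \<longleftrightarrow>
     (\<exists>f. Vector_Spaces.linear (*) scale f \<and> bij f \<and> (\<forall>c. nrm (f c) = val c))"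

lemma Metric_space_nrm: "Metric_space UNIV (\<lambda>v w. nrm (v - w))"
proof -
  have minus: "nrm (- v) \<le> nrm v" for v
    using nrm_diff_le_max[of 0 v] nrm_nonneg[of v] nrm_eq_0_iff[of 0] by simp
  have sym: "nrm (- v) = nrm v" for v
    using minus[of v] minus[of "- v"] by simp
  show ?thesis
  proof
    show "nrm (v - w) = nrm (w - v)" for v w
      using sym[of "v - w"] by simp
    show "nrm (u - w) \<le> nrm (u - v) + nrm (v - w)" for u v w
      using nrm_diff_le_max[of "u - v" "w - v"] sym[of "v - w"]
        nrm_nonneg[of "u - v"] nrm_nonneg[of "v - w"] by (simp add: algebra_simps)
  qed (simp_all add: nrm_nonneg nrm_eq_0_iff)
qed

lemma banach_rank_spec:
  obtains S where "closed_span S = UNIV" "banach_rank = |S|"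
    "\<And>T. closed_span T = UNIV \<Longrightarrow> |S| \<le>o |T|"
proof -
  interpret M: Metric_space UNIV "\<lambda>v w. nrm (v - w)" by (rule Metric_space_nrm)
  let ?R = "card_of ` {S. closed_span S = UNIV}"
  have "closed_span UNIV = UNIV"
    using closure_of_topspace[of norm_topology] by (simp add: closed_span_def span_UNIV)
  then have "?R \<noteq> {}" by blast
  then have "\<exists>r\<in>?R. \<forall>r'\<in>?R. r \<le>o r'"
    using exists_minim_Card_order[of ?R] card_of_Card_order by blast
  then have "\<exists>r. \<exists>S. closed_span S = UNIV \<and> r = |S| \<and>
      (\<forall>T. closed_span T = UNIV \<longrightarrow> |S| \<le>o |T| )" by blast
  from someI_ex[OF this] show thesis
    unfolding banach_rank_def[symmetric] using that by blast
qed

end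

end

theory Submission
  imports Defs
begin

text \<open>
  Over a trivially valued field every coefficient has absolute value \<open>0\<close> or \<open>1\<close>, so a
  family in \<open>C0 E\<close> has finite support and its norm is \<open>0\<close> or \<open>1\<close>. Hence the
  norm of a free space takes only these two values (\<open>is_free_imp_nrm_subset\<close>). Conversely, if
  the norm of a subspace takes only the values \<open>0\<close> and \<open>1\<close>, then the subspace is discrete, and
  every algebraic basis of it is an orthonormal Schauder basis
  (\<open>subspace_is_free\<close>). This gives the equivalence of freeness with \<open>\<parallel>V\<parallel> \<subseteq> |k|\<close>; and
  since the latter condition passes to subspaces, it also gives almost freeness.
  If moreover \<open>V\<close> is a line spanned by \<open>s\<close>, then \<open>\<parallel>s\<parallel> = 1\<close>, so scaling \<open>s\<close> is an isometry
  from the field onto \<open>V\<close>.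

  For the remaining implication let \<open>V\<close> be almost free. If \<open>rank V \<ge> 2\<close>, then every line
  \<open>\<langle>{v}\<rangle>\<close> is free, so \<open>\<parallel>v\<parallel>\<close> is \<open>0\<close> or \<open>1\<close>. If \<open>rank V \<le> 1\<close>, then
  \<open>V = \<langle>{s}\<rangle>\<close> for some \<open>s\<close>, and almost freeness gives no information on
  \<open>\<parallel>s\<parallel>\<close>; but a line is discrete, hence closed, so \<open>V\<close> is the algebraic span of \<open>s\<close>.
  Either \<open>V = 0\<close>, or the condition on one-dimensional spaces applies.
\<close>

context banach_vector_space
begin

lemma nrm_zero [simp]: "nrm 0 = 0"
  by (simp add: nrm_eq_0_iff)

lemma sums_to_unique:
  assumes "sums_to E c v" "sums_to E c w"
  shows "v = w"
proof -
  interpret M: Metric_space UNIV "\<lambda>v w. nrm (v - w)" by (rule Metric_space_nrm)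
  show ?thesis
    using assms M.limitin_metric_unique finite_subsets_at_top_neq_bot
    unfolding sums_to_def by blast
qed

text \<open>A subspace with a single nonzero norm value is discrete, and therefore closed by the
  ultrametric inequality.\<close>

lemma closed_span_eq_span:
  assumes r: "0 < r" and S: "nrm ` span S \<subseteq> {0, r}"
  shows "closed_span S = span S"
proof
  interpret M: Metric_space UNIV "\<lambda>v w. nrm (v - w)" by (rule Metric_space_nrm)
  show "span S \<subseteq> closed_span S"
    unfolding closed_span_def by (rule closure_of_subset) simp
  show "closed_span S \<subseteq> span S"
  proof
    fix v assume "v \<in> closed_span S"
    then have near: "\<exists>w\<in>span S. nrm (v - w) < \<epsilon>" if "0 < \<epsilon>" for \<epsilon>
      using that unfolding closed_span_def M.metric_closure_of by (auto simp: M.mball_def)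
    obtain w where w: "w \<in> span S" "nrm (v - w) < r"
      using near[OF r] by blast
    have "v = w"
    proof (rule ccontr)
      assume "v \<noteq> w"
      then have "0 < nrm (v - w)"
        using nrm_nonneg[of "v - w"] nrm_eq_0_iff[of "v - w"] by simp
      then obtain w' where w': "w' \<in> span S" "nrm (v - w') < nrm (v - w)"
        using near by blast
      have "nrm (w' - w) < r"
        using nrm_diff_le_max[of "v - w" "v - w'"] w(2) w'(2) by simp
      moreover have "nrm (w' - w) \<in> {0, r}"
        using S span_diff[OF w'(1) w(1)] by blast
      ultimately have "w' = w"
        by (simp add: nrm_eq_0_iff)
      with w'(2) show False by simp
    qed
    with w(1) show "v \<in> span S" by simp
  qed
qed

end

text \<open>A Banach space over a field with the trivial valuation.\<close>

locale trivially_valued_banach_space = banach_vector_space val scale nrm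
  for val :: "'k::field \<Rightarrow> real"
    and scale :: "'k \<Rightarrow> 'v::ab_group_add \<Rightarrow> 'v"
    and nrm :: "'v \<Rightarrow> real" +
  assumes val_trivial: "c \<noteq> 0 \<Longrightarrow> val c = 1"
begin

lemma val_eq: "val c = (if c = 0 then 0 else 1)"
  using val_trivial val_eq_0_iff by simp

lemma range_val: "range val = {0, 1}"
proof
  show "{0, 1} \<subseteq> range val"
    using val_eq[of 0] val_eq[of 1] by (metis empty_subsetI insert_subset rangeI zero_neq_one)
qed (auto simp: val_eq)

lemma finite_support_C0:
  assumes "c \<in> C0 E"
  shows "finite {e \<in> E. c e \<noteq> 0}"
proof -
  have "finite {e \<in> E. 1 \<le> val (c e)}"
    using assms by (simp add: C0_def)
  moreover have "{e \<in> E. c e \<noteq> 0} = {e \<in> E. 1 \<le> val (c e)}"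
    by (auto simp: val_eq)
  ultimately show ?thesis by simp
qed

lemma C0_norm_eq: "C0_norm E c = (if \<exists>e\<in>E. c e \<noteq> 0 then 1 else 0)"
proof (cases "\<exists>e\<in>E. c e \<noteq> 0")
  case True
  then obtain e where e: "e \<in> E" "c e \<noteq> 0" by blast
  have "(SUP e\<in>E. val (c e)) = 1"
    using e by (intro cSup_eq_maximum) (auto simp: val_eq intro!: rev_image_eqI)
  with e show ?thesis by (auto simp: C0_norm_def)
next
  case False
  then have "(SUP e\<in>E. val (c e)) = (SUP e\<in>E. 0)"
    by (intro SUP_cong) (auto simp: val_eq)
  with False show ?thesis by (auto simp: C0_norm_def)
qed

text \<open>The net of finite partial sums is constant from the support on.\<close>

lemma sums_to_sum_support:
  assumes "c \<in> C0 E"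
  shows "sums_to E c (\<Sum>e | e \<in> E \<and> c e \<noteq> 0. scale (c e) e)"
proof -
  interpret M: Metric_space UNIV "\<lambda>v w. nrm (v - w)" by (rule Metric_space_nrm)
  let ?F = "{e \<in> E. c e \<noteq> 0}"
  have "\<forall>\<^sub>F X in finite_subsets_at_top E.
      (\<Sum>e\<in>X. scale (c e) e) = (\<Sum>e\<in>?F. scale (c e) e)"
    unfolding eventually_finite_subsets_at_top
  proof (intro exI[of _ ?F] conjI allI impI)
    fix X assume "finite X \<and> ?F \<subseteq> X \<and> X \<subseteq> E"
    then show "(\<Sum>e\<in>X. scale (c e) e) = (\<Sum>e\<in>?F. scale (c e) e)"
      by (intro sum.mono_neutral_right) auto
  qed (use finite_support_C0[OF assms] in auto)
  then show ?thesis
    unfolding sums_to_def by (intro limitin_eventually) simp_all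
qed

lemma is_free_imp_nrm_subset:
  assumes "is_free W"
  shows "nrm ` W \<subseteq> {0, 1}"
proof
  fix r assume "r \<in> nrm ` W"
  then obtain v where v: "v \<in> W" "r = nrm v" by blast
  obtain E where E: "orthonormal_schauder_basis W E"
    using assms is_free_def by blast
  obtain c where c: "c \<in> C0 E" "sums_to E c v"
    using E v(1) unfolding orthonormal_schauder_basis_def by blast
  obtain w where "sums_to E c w" "nrm w = C0_norm E c"
    using E c(1) unfolding orthonormal_schauder_basis_def by blast
  with c(2) v(2) have "r = C0_norm E c"
    using sums_to_unique by blast
  then show "r \<in> {0, 1}"
    by (simp add: C0_norm_eq)
qed

text \<open>Every algebraic basis \<open>E\<close> of \<open>W\<close> works: by linear independence a nonzero
  family of coefficients has a nonzero sum, which has norm \<open>1\<close> as required.\<close>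

lemma subspace_is_free:
  assumes W: "subspace W" and norms: "nrm ` W \<subseteq> {0, 1}"
  shows "is_free W"
proof -
  obtain E where E: "E \<subseteq> W" "independent E" "W \<subseteq> span E"
    using maximal_independent_subset by blast
  have nrm_1: "nrm v = 1" if "v \<in> W" "v \<noteq> 0" for v
    using norms that nrm_eq_0_iff[of v] by auto
  have "orthonormal_schauder_basis W E"
    unfolding orthonormal_schauder_basis_def
  proof (intro conjI ballI)
    show "nrm e = 1" if "e \<in> E" for e
      using that E dependent_zero by (intro nrm_1) auto
  next
    fix c :: "'v \<Rightarrow> 'k" assume c: "c \<in> C0 E"
    let ?F = "{e \<in> E. c e \<noteq> 0}" and ?v = "\<Sum>e | e \<in> E \<and> c e \<noteq> 0. scale (c e) e"
    have "?v \<in> W"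
      using E(1) by (intro subspace_sum[OF W] subspace_scale[OF W]) auto
    moreover have "?v \<noteq> 0" if "\<exists>e\<in>E. c e \<noteq> 0"
    proof
      assume "?v = 0"
      from that obtain e where "e \<in> ?F" by blast
      then have "c e = 0"
        using independentD[OF E(2) finite_support_C0[OF c] _ \<open>?v = 0\<close>] by blast
      with \<open>e \<in> ?F\<close> show False by simp
    qed
    moreover have "?v = 0" if "\<not> (\<exists>e\<in>E. c e \<noteq> 0)"
      using that by (intro sum.neutral) auto
    ultimately have "nrm ?v = C0_norm E c"
      using nrm_1 by (simp add: C0_norm_eq)
    with \<open>?v \<in> W\<close> sums_to_sum_support[OF c]
    show "\<exists>v\<in>W. sums_to E c v \<and> nrm v = C0_norm E c" by blast
  next
    fix v assume "v \<in> W"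
    with E(3) have v: "v \<in> span E" by blast
    define c where "c = restrict (representation E v) E"
    have supp: "{e \<in> E. c e \<noteq> 0} = {e. representation E v e \<noteq> 0}"
      using representation_ne_zero by (fastforce simp: c_def)
    have "finite {e \<in> E. \<epsilon> \<le> val (c e)}" if "0 < \<epsilon>" for \<epsilon>
    proof (rule finite_subset)
      show "{e \<in> E. \<epsilon> \<le> val (c e)} \<subseteq> {e \<in> E. c e \<noteq> 0}"
        using that by (auto simp: val_eq)
      show "finite {e \<in> E. c e \<noteq> 0}"
        unfolding supp by (rule finite_representation)
    qed
    then have c: "c \<in> C0 E"
      by (auto simp: C0_def c_def)
    have "(\<Sum>e | e \<in> E \<and> c e \<noteq> 0. scale (c e) e)
        = (\<Sum>e | representation E v e \<noteq> 0. scale (representation E v e) e)"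
      unfolding supp using representation_ne_zero by (intro sum.cong) (auto simp: c_def)
    also have "\<dots> = v"
      by (rule sum_nonzero_representation_eq[OF E(2) v])
    finally show "\<exists>c\<in>C0 E. sums_to E c v"
      using c sums_to_sum_support[OF c] by auto
  qed (rule E(1))
  then show ?thesis
    unfolding is_free_def by blast
qed

lemma is_free_UNIV_iff: "is_free UNIV \<longleftrightarrow> range nrm \<subseteq> {0, 1}"
  using is_free_imp_nrm_subset[of UNIV] subspace_is_free[OF subspace_UNIV] by (rule iffI)

lemma closed_span_singleton: "closed_span {s} = span {s}"
proof (rule closed_span_eq_span)
  \<comment> \<open>If \<open>s = 0\<close> any positive value serves as the only possible nonzero norm.\<close>
  let ?r = "if s = 0 then 1 else nrm s"
  show "0 < ?r"
    using nrm_nonneg[of s] nrm_eq_0_iff[of s] by auto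
  show "nrm ` span {s} \<subseteq> {0, ?r}"
    by (auto simp: span_singleton nrm_scale val_eq)
qed

lemma almost_free_if_nrm_subset:
  assumes "range nrm \<subseteq> {0, 1}"
  shows almost_free
  unfolding almost_free_def kappa_free_def
proof (intro allI impI)
  fix S
  have norms: "nrm ` span S \<subseteq> {0, 1}"
    using assms by blast
  show "is_free (closed_span S)"
    unfolding closed_span_eq_span[OF zero_less_one norms]
    by (rule subspace_is_free[OF subspace_span norms])
qed

lemma isometric_to_field_if_nrm_subset:
  assumes norms: "range nrm \<subseteq> {0, 1}" and dim: "dim (UNIV :: 'v set) = 1"
  shows isometric_to_field
proof -
  obtain B where B: "independent B" "UNIV \<subseteq> span B" "card B = 1"
    using basis_exists[of UNIV] dim by metis
  obtain s where s: "B = {s}"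
    using B(3) card_1_singletonE by blast
  have "s \<noteq> 0"
    using B(1) s dependent_zero by blast
  then have "nrm s = 1"
    using norms nrm_eq_0_iff[of s] by auto
  show ?thesis
    unfolding isometric_to_field_def
  proof (intro exI[of _ "\<lambda>c. scale c s"] conjI allI)
    show "Vector_Spaces.linear (*) scale (\<lambda>c. scale c s)"
      by unfold_locales (simp_all add: algebra_simps)
    show "bij (\<lambda>c. scale c s)"
      unfolding bij_def
    proof
      show "inj (\<lambda>c. scale c s)"
        using \<open>s \<noteq> 0\<close> by (auto intro!: injI)
      show "surj (\<lambda>c. scale c s)"
        using B(2) s by (auto simp: span_singleton)
    qed
    show "nrm (scale c s) = val c" for c
      by (simp add: nrm_scale \<open>nrm s = 1\<close>)
  qed
qed

lemma nrm_subset_if_almost_free: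
  assumes af: almost_free and iso: "dim (UNIV :: 'v set) = 1 \<Longrightarrow> isometric_to_field"
  shows "range nrm \<subseteq> {0, 1}"
proof -
  obtain S where S: "closed_span S = UNIV" "banach_rank = |S|"
    using banach_rank_spec by metis
  show ?thesis
  proof (cases "\<exists>s. S \<subseteq> {s}")
    case False
    have "nrm v \<in> {0, 1}" for v
    proof -
      have "\<not> |S| \<le>o |{v}|"
      proof
        assume "|S| \<le>o |{v}|"
        then obtain f where "inj_on f S" "f ` S \<subseteq> {v}"
          using card_of_ordLeq[of S "{v}"] by blast
        then have "\<forall>x\<in>S. \<forall>y\<in>S. x = y"
          unfolding inj_on_def by blast
        with False show False by blast
      qed
      then have "|{v}| <o |S|"
        by (simp add: card_of_Well_order not_ordLeq_iff_ordLess)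
      then have "is_free (closed_span {v})"
        using af S(2) unfolding almost_free_def kappa_free_def by simp
      then show ?thesis
        using is_free_imp_nrm_subset span_base[of v "{v}"]
        unfolding closed_span_singleton by blast
    qed
    then show ?thesis by blast
  next
    case True
    then obtain s where "S \<subseteq> {s}" by blast
    then have "closed_span S \<subseteq> closed_span {s}"
      unfolding closed_span_def by (intro closure_of_mono span_mono)
    with S(1) have line: "span {s} = UNIV"
      unfolding closed_span_singleton by blast
    show ?thesis
    proof (cases "s = 0")
      case True
      with line have "v = 0" for v :: 'v by (auto simp: span_singleton)
      then have "nrm v = 0" for v by (simp add: nrm_eq_0_iff)
      then show ?thesis by blast
    next
      case False
      then have "independent {s}" by simp
      then have "dim (UNIV :: 'v set) = 1"
        using dim_eq_card[of "{s}" UNIV] line by simp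
      then obtain f where f: "bij f" "\<And>c. nrm (f c) = val c"
        using iso unfolding isometric_to_field_def by blast
      have "nrm v \<in> range val" for v
      proof -
        obtain c where "v = f c"
          using surjD[OF bij_is_surj[OF f(1)]] by blast
        with f(2) show ?thesis by simp
      qed
      then show ?thesis by (auto simp: range_val)
    qed
  qed
qed

end

theorem proposition4p2:
  fixes val :: "'k::field \<Rightarrow> real"
    and scale :: "'k \<Rightarrow> 'v::ab_group_add \<Rightarrow> 'v"
    and nrm :: "'v \<Rightarrow> real"
  assumes "complete_valued_field val"
    and "\<forall>c. c \<noteq> 0 \<longrightarrow> val c = 1"
    and "banach_vector_space val scale nrm"
  shows "(banach_vector_space.is_free val scale nrm UNIV \<longleftrightarrow>
            banach_vector_space.almost_free val scale nrm \<and>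
            (vector_space.dim scale (UNIV :: 'v set) = 1 \<longrightarrow>
               banach_vector_space.isometric_to_field val scale nrm)) \<and>
         (banach_vector_space.is_free val scale nrm UNIV \<longleftrightarrow>
            range nrm \<subseteq> range val)"
proof -
  interpret trivially_valued_banach_space val scale nrm
    using assms by (simp add: trivially_valued_banach_space_def
        trivially_valued_banach_space_axioms_def)
  show ?thesis
    unfolding is_free_UNIV_iff range_val
    using almost_free_if_nrm_subset isometric_to_field_if_nrm_subset nrm_subset_if_almost_free
    by blast
qed

end
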